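(* Let $(\mathbf m_{hn},\bar\rho_{hn})\in V_h\times Q_h$ solve the fully discrete finite element approximation $$(F(|\mathbf m_{hn}|)\mathbf m_{hn},\mathbf v)-(\bar\rho_{hn},\nabla\cdot\mathbf v)=-(\nabla\Psi_n,\mathbf v)\quad\text{for all }\mathbf v\in V_h,$$ $$\Big(\phi\,\frac{\bar\rho_{hn}-\bar\rho_{h,n-1}}{\Delta t},q\Big)+(\nabla\cdot\mathbf m_{hn},q)=(f_n,q)-(\phi\Psi_{tn},q)\quad\text{for all }q\in Q_h,$$ for each time step $n=1,2,\dots,M$, with $\bar\rho_{h0}=\pi\bar\rho_0$. Then there exists a positive constant $C$ independent of $n,\Delta t$ such that for $\Delta t$ sufficiently small $$\|\bar\rho_{hn}\|_{L^2(\Omega)}^2+\sum_{i=1}^n\Delta t\,\|\mathbf m_{hi}\|_{L^s(\Omega)}^s\le C\Big(\|\bar\rho_0\|_{L^2(\Omega)}^2+\sum_{i=1}^n\Delta t\big(\|f_i\|_{L^2(\Omega)}^2+\|\Psi_{ti}\|_{L^2(\Omega)}^2+\|\nabla\Psi_i\|_{L^{s^*}(\Omega)}^{s^*}\big)\Big).$$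
   Context: $\Omega\subset\mathbb R^d$ ($d\ge2$) is open, bounded, with $C^1$ boundary; $T>0$, $I=[0,T]$; $(\cdot,\cdot)$ is the integral pairing over $\Omega$ of scalar or vector functions. $\{t_n\}_{n=0}^M$ is the uniform partition of $[0,T]$ with $t_n=n\Delta t$, and $\varphi_n=\varphi(\cdot,t_n)$; in particular $f_n=f(\cdot,t_n)\in L^2(\Omega)$, $\Psi_n=\Psi(\cdot,t_n)$, $\Psi_{tn}=\Psi_t(\cdot,t_n)$, with $\Psi_n,\Psi_{tn}\in C(\bar\Omega)$. Fix $N\ge1$ and real exponents $\alpha_{-1}=-\alpha<\alpha_0=0<\alpha_1<\dots<\alpha_N$ with $\alpha\in(0,1)$; put $s=\alpha_N+2$, $s^*=s/(s-1)$. $F(z)=\sum_{i=-1}^N a_i(\mathbf x,t)z^{\alpha_i}$ (evaluated at $t=t_n$ in the scheme), and $F(|\mathbf m|)\mathbf m$ is understood as $0$ where $\mathbf m=0$. The coefficients $a_{-1},\dots,a_N\in W^{1,\infty}(I,L^\infty(\Omega))$ satisfy for a.e. $(\mathbf x,t)$: $0<a_*<a_{-1},a_0,a_N<a^*<\infty$; $0\le a_i\le a^*$ for $i=1,\dots,N-1$; $|\partial_ta_i|<b^*<\infty$ for $i=-1,\dots,N$. Data: $0<\phi_*\le\phi(\mathbf x)\le\phi^*<\infty$; $f\in L^\infty(I,L^2(\Omega))$; $\psi\in C^{1,2}_{\mathbf x,t}(\bar\Omega\times I)$; $\Psi$ is an extension of the boundary datum $\psi$ from $\partial\Omega\times I$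 to $\bar\Omega\times I$; $\rho_0$ is the initial density and $\bar\rho_0=\rho_0-\Psi(\cdot,0)$. Spaces: $\{\mathcal T_h\}_h$ is a family of globally quasi-uniform triangulations of $\Omega$ with $\max_{\tau\in\mathcal T_h}\operatorname{diam}\tau\le h$; for an integer $k\ge0$, $Q_h=\{\rho_h\in C^0(\overline\Omega):\rho_h|_\tau\in P_k(\tau)\ \forall\tau\in\mathcal T_h\}$, $V_h=\{\mathbf m_h\in C^0(\overline\Omega)^d:\mathbf m_h|_\tau\in P_k(\tau)\ \forall\tau\in\mathcal T_h\}$ (componentwise), $P_k(\tau)$ being the polynomials of degree at most $k$. $\pi$ is the $L^2$-projection onto $Q_h$. Convention of the paper: $C$ denotes a positive generic constant depending on the exponents and coefficients of $F$, the dimension $d$ and the domain $\Omega$, and independent of the initial and boundary data and of the time step. *)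

theory Defs
  imports "HOL-Analysis.Analysis" "HOL-Probability.Essential_Supremum"
begin

section \<open>Smoothness and domains\<close>

text \<open>Intended for open \<open>U\<close>: all partial derivatives up to order \<open>k\<close> are continuous on \<open>U\<close>.\<close>

primrec Ck_on :: "nat \<Rightarrow> 'a::euclidean_space set \<Rightarrow> ('a \<Rightarrow> real) \<Rightarrow> bool" where
  "Ck_on 0 U f \<longleftrightarrow> continuous_on U f"
| "Ck_on (Suc k) U f \<longleftrightarrow>
     (\<forall>x\<in>U. f differentiable (at x)) \<and>
     (\<forall>b\<in>Basis. Ck_on k U (\<lambda>x. frechet_derivative f (at x) b))"

definition test_functions :: "'a::euclidean_space set \<Rightarrow> ('a \<Rightarrow> real) set" where
  "test_functions U =
     {\<eta>. (\<forall>k. Ck_on k UNIV \<eta>) \<and> compact (closure {x. \<eta> x \<noteq> 0}) \<and> closure {x. \<eta> x \<noteq> 0} \<subseteq> U}"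

text \<open>Near each boundary point, \<open>\<Omega>\<close> is the part of a ball strictly above the graph of a
  \<open>C\<^sup>1\<close> function over the hyperplane orthogonal to a unit vector \<open>e\<close>;
  \<open>x - (x \<bullet> e) *\<^sub>R e\<close> is the projection of \<open>x\<close> to that hyperplane.\<close>

definition C1_boundary :: "'a::euclidean_space set \<Rightarrow> bool" where
  "C1_boundary \<Omega> \<longleftrightarrow>
     (\<forall>p\<in>frontier \<Omega>. \<exists>r>0. \<exists>e \<gamma>. norm e = 1 \<and> Ck_on 1 UNIV \<gamma> \<and>
        \<Omega> \<inter> ball p r = {x \<in> ball p r. \<gamma> (x - (x \<bullet> e) *\<^sub>R e) < x \<bullet> e})"

text \<open>\<open>C\<^sup>1\<close> in space and \<open>C\<^sup>2\<close> in time, with all these derivatives continuous up to the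
  boundary: \<open>G\<close>, \<open>P\<close>, \<open>Q\<close> are the (extended) spatial gradient and the first and second time
  derivatives. Here and below, functions of space and time take the time argument first.\<close>

definition C12 :: "real \<Rightarrow> 'a::euclidean_space set \<Rightarrow> (real \<Rightarrow> 'a \<Rightarrow> real) \<Rightarrow> bool" where
  "C12 T \<Omega> \<psi> \<longleftrightarrow>
     (\<exists>G P Q.
        continuous_on ({0..T} \<times> closure \<Omega>) (\<lambda>(t, x). \<psi> t x) \<and>
        continuous_on ({0..T} \<times> closure \<Omega>) (\<lambda>(t, x). G t x :: 'a) \<and>
        continuous_on ({0..T} \<times> closure \<Omega>) (\<lambda>(t, x). P t x) \<and>
        continuous_on ({0..T} \<times> closure \<Omega>) (\<lambda>(t, x). Q t x) \<and>
        (\<forall>t\<in>{0..T}. \<forall>x\<in>\<Omega>. (\<psi> t has_derivative (\<lambda>h. G t x \<bullet> h)) (at x)) \<and>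
        (\<forall>t\<in>{0..T}. \<forall>x\<in>closure \<Omega>.
           ((\<lambda>r. \<psi> r x) has_real_derivative P t x) (at t within {0..T}) \<and>
           ((\<lambda>r. P r x) has_real_derivative Q t x) (at t within {0..T})))"


section \<open>Lebesgue spaces, weak gradients, and Bochner--Sobolev spaces in time\<close>

definition Lp :: "real \<Rightarrow> 'a::euclidean_space set \<Rightarrow> ('a \<Rightarrow> 'b::euclidean_space) set" where
  "Lp p U = {u. u \<in> borel_measurable (lebesgue_on U) \<and>
                integrable (lebesgue_on U) (\<lambda>x. norm (u x) powr p)}"

definition Lp_norm :: "real \<Rightarrow> 'a::euclidean_space set \<Rightarrow> ('a \<Rightarrow> 'b::euclidean_space) \<Rightarrow> real" where
  "Lp_norm p U u = (LINT x|lebesgue_on U. norm (u x) powr p) powr (1 / p)"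

definition Linf :: "'a::euclidean_space set \<Rightarrow> ('a \<Rightarrow> real) set" where
  "Linf U = {u. u \<in> borel_measurable (lebesgue_on U) \<and>
                esssup (lebesgue_on U) (\<lambda>x. ereal \<bar>u x\<bar>) < \<infinity>}"

definition Linf_norm :: "'a::euclidean_space set \<Rightarrow> ('a \<Rightarrow> real) \<Rightarrow> real" where
  "Linf_norm U u = real_of_ereal (esssup (lebesgue_on U) (\<lambda>x. ereal \<bar>u x\<bar>))"

definition pairing ::
  "'a::euclidean_space set \<Rightarrow> ('a \<Rightarrow> 'b::euclidean_space) \<Rightarrow> ('a \<Rightarrow> 'b) \<Rightarrow> real" where
  "pairing U u v = (LINT x|lebesgue_on U. u x \<bullet> v x)"

definition weak_gradient ::
  "'a::euclidean_space set \<Rightarrow> ('a \<Rightarrow> real) \<Rightarrow> ('a \<Rightarrow> 'a) \<Rightarrow> bool" where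
  "weak_gradient U u G \<longleftrightarrow>
     (\<forall>K. compact K \<and> K \<subseteq> U \<longrightarrow> integrable (lebesgue_on K) u \<and> integrable (lebesgue_on K) G) \<and>
     (\<forall>\<eta>\<in>test_functions U. \<forall>b\<in>Basis.
        (LINT x|lebesgue_on U. u x * frechet_derivative \<eta> (at x) b) =
        - (LINT x|lebesgue_on U. (G x \<bullet> b) * \<eta> x))"

text \<open>\<open>L\<^sup>\<infinity>(I, X)\<close> in the sense of Bochner for \<open>I = [0,T]\<close>, where \<open>X\<close> is a space of functions with
  norm \<open>N\<close>: the strong measurability is approximation by simple functions \<open>\<sigma> k\<close>.\<close>

definition Linf_Bochner ::
  "real \<Rightarrow> ('a \<Rightarrow> real) set \<Rightarrow> (('a \<Rightarrow> real) \<Rightarrow> real) \<Rightarrow> (real \<Rightarrow> 'a \<Rightarrow> real) set" where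
  "Linf_Bochner T X N =
     {u. (AE t in lebesgue_on {0..T}. u t \<in> X) \<and>
         (\<exists>\<sigma> :: nat \<Rightarrow> real \<Rightarrow> 'a \<Rightarrow> real.
            (\<forall>k. finite (\<sigma> k ` {0..T}) \<and> \<sigma> k ` {0..T} \<subseteq> X \<and>
                 (\<forall>g. {t \<in> {0..T}. \<sigma> k t = g} \<in> sets lebesgue)) \<and>
            (AE t in lebesgue_on {0..T}. (\<lambda>k. N (\<lambda>x. \<sigma> k t x - u t x)) \<longlonglongrightarrow> 0)) \<and>
         (\<exists>K. AE t in lebesgue_on {0..T}. N (u t) \<le> K)}"

text \<open>\<open>u \<in> W\<^sup>1\<^sup>,\<^sup>\<infinity>(I, L\<^sup>\<infinity>(U))\<close> with \<open>\<partial>\<^sub>t u = u'\<close>. The identity of Bochner integrals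
  defining the weak derivative is an identity in \<open>L\<^sup>\<infinity>(U)\<close>, expressed by pairing with all
  \<open>w \<in> L\<^sup>1(U)\<close>. As usual, \<open>u\<close> stands for its representative that is continuous from \<open>I\<close> to
  \<open>L\<^sup>\<infinity>(U)\<close>; this gives a meaning to \<open>u t\<close> for each single \<open>t\<close>. Both functions are
  measurable in time and space jointly, so that pointwise conditions almost everywhere on
  \<open>I \<times> U\<close> make sense.\<close>

definition W1inf_with_derivative ::
  "real \<Rightarrow> 'a::euclidean_space set \<Rightarrow> (real \<Rightarrow> 'a \<Rightarrow> real) \<Rightarrow> (real \<Rightarrow> 'a \<Rightarrow> real) \<Rightarrow> bool" where
  "W1inf_with_derivative T U u u' \<longleftrightarrow>
     u \<in> Linf_Bochner T (Linf U) (Linf_norm U) \<and>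
     u' \<in> Linf_Bochner T (Linf U) (Linf_norm U) \<and>
     (\<lambda>(t, x). u t x) \<in> borel_measurable (lebesgue_on ({0..T} \<times> U)) \<and>
     (\<lambda>(t, x). u' t x) \<in> borel_measurable (lebesgue_on ({0..T} \<times> U)) \<and>
     (\<forall>\<eta>\<in>test_functions {0<..<T}. \<forall>w\<in>Lp 1 U.
        (LINT t|lebesgue_on {0..T}. deriv \<eta> t * pairing U (u t) w) =
        - (LINT t|lebesgue_on {0..T}. \<eta> t * pairing U (u' t) w)) \<and>
     (\<forall>t\<in>{0..T}. u t \<in> Linf U \<and>
        ((\<lambda>r. Linf_norm U (\<lambda>x. u r x - u t x)) \<longlongrightarrow> 0) (at t within {0..T}))"


section \<open>Finite element spaces\<close>

text \<open>A possibly curved simplex: \<open>G\<close> is a \<open>C\<^sup>1\<close> diffeomorphism from a neighbourhood of the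
  nondegenerate simplex with vertex set \<open>S\<close> to its image.\<close>

definition simplex_chart :: "('a::euclidean_space \<Rightarrow> 'a) \<Rightarrow> 'a set \<Rightarrow> 'a set \<Rightarrow> bool" where
  "simplex_chart G S \<tau> \<longleftrightarrow>
     \<not> affine_dependent S \<and> card S = DIM('a) + 1 \<and> \<tau> = G ` (convex hull S) \<and>
     (\<exists>U. open U \<and> convex hull S \<subseteq> U \<and> inj_on G U \<and>
          (\<forall>b\<in>Basis. Ck_on 1 U (\<lambda>x. G x \<bullet> b)) \<and>
          (\<forall>x\<in>U. inj (frechet_derivative G (at x))))"

text \<open>A domain with \<open>C\<^sup>1\<close> boundary is not a polytope, so elements that meet the boundary may be
  curved; all others are ordinary simplices. Two distinct elements meet in a common proper face,
  which is the empty set if \<open>A = A' = {}\<close>.\<close>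

definition triangulation :: "'a::euclidean_space set \<Rightarrow> 'a set set \<Rightarrow> bool" where
  "triangulation \<Omega> \<T> \<longleftrightarrow>
     finite \<T> \<and> \<Union>\<T> = closure \<Omega> \<and>
     (\<exists>G S. (\<forall>\<tau>\<in>\<T>. simplex_chart (G \<tau>) (S \<tau>) \<tau> \<and>
                    (\<tau> \<inter> frontier \<Omega> = {} \<longrightarrow> (\<forall>x\<in>convex hull (S \<tau>). G \<tau> x = x))) \<and>
            (\<forall>\<tau>\<in>\<T>. \<forall>\<tau>'\<in>\<T>. \<tau> \<noteq> \<tau>' \<longrightarrow>
               (\<exists>A A'. A \<subset> S \<tau> \<and> A' \<subset> S \<tau>' \<and>
                  \<tau> \<inter> \<tau>' = G \<tau> ` (convex hull A) \<and> \<tau> \<inter> \<tau>' = G \<tau>' ` (convex hull A'))))"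

text \<open>A family \<open>\<T> h\<close>, \<open>h \<in> H\<close>, with mesh size at most \<open>h\<close> and, uniformly in the family, with
  an inscribed ball of radius comparable to \<open>h\<close> in each element (global quasi-uniformity).\<close>

definition quasi_uniform_triangulations ::
  "'a::euclidean_space set \<Rightarrow> real set \<Rightarrow> (real \<Rightarrow> 'a set set) \<Rightarrow> bool" where
  "quasi_uniform_triangulations \<Omega> H \<T> \<longleftrightarrow>
     (\<forall>h\<in>H. 0 < h \<and> triangulation \<Omega> (\<T> h) \<and> (\<forall>\<tau>\<in>\<T> h. diameter \<tau> \<le> h)) \<and>
     (\<exists>c>0. \<forall>h\<in>H. \<forall>\<tau>\<in>\<T> h. \<exists>x. ball x (c * h) \<subseteq> \<tau>)"

text \<open>Polynomials of total degree at most \<open>k\<close>; \<open>\<beta>\<close> ranges over the multi-indices.\<close>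

definition polys :: "nat \<Rightarrow> ('a::euclidean_space \<Rightarrow> real) set" where
  "polys k = {p. \<exists>c :: ('a \<Rightarrow> nat) \<Rightarrow> real.
     p = (\<lambda>x. \<Sum>\<beta> | \<beta> \<in> extensional Basis \<and> sum \<beta> Basis \<le> k.
                c \<beta> * (\<Prod>b\<in>Basis. (x \<bullet> b) ^ \<beta> b))}"

definition Qh :: "nat \<Rightarrow> 'a::euclidean_space set \<Rightarrow> 'a set set \<Rightarrow> ('a \<Rightarrow> real) set" where
  "Qh k \<Omega> \<T> = {q. continuous_on (closure \<Omega>) q \<and> (\<forall>\<tau>\<in>\<T>. \<exists>p\<in>polys k. \<forall>x\<in>\<tau>. q x = p x)}"

definition Vh :: "nat \<Rightarrow> 'a::euclidean_space set \<Rightarrow> 'a set set \<Rightarrow> ('a \<Rightarrow> 'a) set" where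
  "Vh k \<Omega> \<T> = {v. continuous_on (closure \<Omega>) v \<and>
     (\<forall>b\<in>Basis. \<forall>\<tau>\<in>\<T>. \<exists>p\<in>polys k. \<forall>x\<in>\<tau>. v x \<bullet> b = p x)}"

text \<open>For \<open>v \<in> V\<^sub>h\<close> this is meaningful in the interiors of the elements, hence almost everywhere,
  and agrees with the weak divergence since \<open>v\<close> is continuous.\<close>

definition divergence :: "('a::euclidean_space \<Rightarrow> 'a) \<Rightarrow> 'a \<Rightarrow> real" where
  "divergence v x = (\<Sum>b\<in>Basis. frechet_derivative v (at x) b \<bullet> b)"

definition is_L2_projection ::
  "'a::euclidean_space set \<Rightarrow> ('a \<Rightarrow> real) set \<Rightarrow> ('a \<Rightarrow> real) \<Rightarrow> ('a \<Rightarrow> real) \<Rightarrow> bool" where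
  "is_L2_projection \<Omega> W u w \<longleftrightarrow> w \<in> W \<and> (\<forall>q\<in>W. pairing \<Omega> (\<lambda>x. u x - w x) q = 0)"


section \<open>The generalized Forchheimer scheme\<close>

definition forchheimer ::
  "nat \<Rightarrow> (int \<Rightarrow> real) \<Rightarrow> (int \<Rightarrow> real \<Rightarrow> 'a \<Rightarrow> real) \<Rightarrow> real \<Rightarrow> 'a \<Rightarrow> real \<Rightarrow> real" where
  "forchheimer N e a t x z = (\<Sum>i\<in>{-1..int N}. a i t x * z powr e i)"

text \<open>Time step \<open>n\<close> of the scheme with step size \<open>\<Delta>\<close>. The product of \<open>F(|m|)\<close> and \<open>m\<close>
  vanishes at zeros of \<open>m\<close>.\<close>

definition scheme_step ::
  "nat \<Rightarrow> (int \<Rightarrow> real) \<Rightarrow> (int \<Rightarrow> real \<Rightarrow> 'a::euclidean_space \<Rightarrow> real) \<Rightarrow> 'a set \<Rightarrow>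
   ('a \<Rightarrow> 'a) set \<Rightarrow> ('a \<Rightarrow> real) set \<Rightarrow> ('a \<Rightarrow> real) \<Rightarrow> (real \<Rightarrow> 'a \<Rightarrow> real) \<Rightarrow>
   (real \<Rightarrow> 'a \<Rightarrow> real) \<Rightarrow> (real \<Rightarrow> 'a \<Rightarrow> 'a) \<Rightarrow> real \<Rightarrow>
   (nat \<Rightarrow> 'a \<Rightarrow> 'a) \<Rightarrow> (nat \<Rightarrow> 'a \<Rightarrow> real) \<Rightarrow> nat \<Rightarrow> bool" where
  "scheme_step N e a \<Omega> V Q \<phi> f \<Psi>t grad\<Psi> \<Delta> m \<rho> n \<longleftrightarrow>
     (let t = real n * \<Delta> in
       (\<forall>v\<in>V. pairing \<Omega> (\<lambda>x. forchheimer N e a t x (norm (m n x)) *\<^sub>R m n x) v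
              - pairing \<Omega> (\<rho> n) (divergence v)
              = - pairing \<Omega> (grad\<Psi> t) v) \<and>
       (\<forall>q\<in>Q. pairing \<Omega> (\<lambda>x. \<phi> x * ((\<rho> n x - \<rho> (n - 1) x) / \<Delta>)) q
              + pairing \<Omega> (divergence (m n)) q
              = pairing \<Omega> (f t) q - pairing \<Omega> (\<lambda>x. \<phi> x * \<Psi>t t x) q))"

end

theory Submission
  imports Defs
begin

text \<open>Testing the scheme with \<open>v = m\<^sub>n\<close> and \<open>q = \<rho>\<^sub>n\<close> and adding the two equations cancels the
  divergence terms. The top-order term of \<open>F\<close> alone bounds \<open>(F(|m\<^sub>n|) m\<^sub>n, m\<^sub>n)\<close> from below by
  \<open>a\<^sub>* \<parallel>m\<^sub>n\<parallel>\<^sub>s\<^sup>s\<close>, and the implicit difference quotient controls the increment of the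
  weighted energy \<open>\<integral> \<phi> \<rho>\<^sub>n\<^sup>2\<close>. Young's inequality absorbs the data, and the implicit discrete
  Gronwall inequality, available once \<open>4 \<Delta>t / \<phi>\<^sub>* \<le> 1/2\<close>, sums the steps.\<close>

section \<open>Null sets on time slices and essential bounds\<close>

text \<open>A set and its completion have the same almost-everywhere statements. The passage to
  \<open>lborel\<close> matters because \<open>lborel\<close>, unlike its completion, factors as a
  product measure.\<close>

lemma AE_lebesgue_on_iff:
  assumes "S \<in> sets borel"
  shows "(AE x in lebesgue_on S. P x) \<longleftrightarrow> (AE x in lborel. x \<in> S \<longrightarrow> P x)"
  using assms by (subst AE_restrict_space_iff) (auto simp: AE_completion_iff)

text \<open>Fubini for null sets, carried out in the uncompleted product measure and then
  transferred back to both factors.\<close>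

lemma AE_lebesgue_on_Times:
  fixes A :: "'a::euclidean_space set" and B :: "'b::euclidean_space set"
  assumes A: "A \<in> sets borel" and B: "B \<in> sets borel"
    and P: "AE (x, y) in lebesgue_on (A \<times> B). P x y"
  shows "AE x in lebesgue_on A. AE y in lebesgue_on B. P x y"
proof -
  have "A \<times> B \<in> sets borel"
    using A B by (simp add: borel_Times)
  with P have "AE z in lborel. z \<in> A \<times> B \<longrightarrow> (case z of (x, y) \<Rightarrow> P x y)"
    by (simp add: AE_lebesgue_on_iff)
  then have "AE z in lborel \<Otimes>\<^sub>M lborel. z \<in> A \<times> B \<longrightarrow> (case z of (x, y) \<Rightarrow> P x y)"
    by (simp only: lborel_prod)
  from lborel_pair.AE_pair[OF this] have "AE x in lborel. x \<in> A \<longrightarrow> (AE y in lborel. y \<in> B \<longrightarrow> P x y)"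
    by eventually_elim auto
  then show ?thesis
    using A B by (simp add: AE_lebesgue_on_iff)
qed

lemma Linf_AE_bound:
  assumes "u \<in> Linf U"
  shows "AE x in lebesgue_on U. \<bar>u x\<bar> \<le> Linf_norm U u"
proof -
  let ?E = "esssup (lebesgue_on U) (\<lambda>x. ereal \<bar>u x\<bar>)"
  have "AE x in lebesgue_on U. ereal \<bar>u x\<bar> \<le> ?E"
    by (rule esssup_AE)
  then show ?thesis
  proof eventually_elim
    case (elim x)
    moreover have "?E < \<infinity>"
      using assms by (simp add: Linf_def)
    ultimately show ?case
      \<comment> \<open>The conversion to a real loses nothing: membership in \<open>Linf\<close>
        excludes the value \<open>\<infinity>\<close>, and the lower bound by
        \<open>\<bar>u x\<bar>\<close> excludes \<open>- \<infinity>\<close>.\<close>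
      unfolding Linf_norm_def by (cases ?E) auto
  qed
qed

lemma Linf_I:
  assumes "u \<in> borel_measurable (lebesgue_on U)" "AE x in lebesgue_on U. \<bar>u x\<bar> \<le> B"
  shows "u \<in> Linf U"
proof -
  have "esssup (lebesgue_on U) (\<lambda>x. ereal \<bar>u x\<bar>) \<le> ereal B"
    using assms by (intro esssup_I) auto
  also have "\<dots> < \<infinity>" by simp
  finally show ?thesis
    using assms by (simp add: Linf_def)
qed

lemma Linf_measurable: "u \<in> Linf U \<Longrightarrow> u \<in> borel_measurable (lebesgue_on U)"
  by (simp add: Linf_def)

lemma Linf_diff:
  assumes "u \<in> Linf U" "v \<in> Linf U"
  shows "(\<lambda>x. u x - v x) \<in> Linf U"
proof (rule Linf_I)
  show "(\<lambda>x. u x - v x) \<in> borel_measurable (lebesgue_on U)"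
    using assms by (intro borel_measurable_diff Linf_measurable)
  show "AE x in lebesgue_on U. \<bar>u x - v x\<bar> \<le> Linf_norm U u + Linf_norm U v"
    using assms[THEN Linf_AE_bound] by eventually_elim linarith
qed

text \<open>Almost every time slice satisfies the bound; continuity into \<open>L\<^sup>\<infinity>\<close> transfers it to the
  exceptional times.\<close>

lemma W1inf_lower_bound:
  fixes U :: "'a::euclidean_space set"
  assumes W: "W1inf_with_derivative T U u u'" and U: "open U" and T: "0 < T"
    and c: "AE (t, x) in lebesgue_on ({0..T} \<times> U). c \<le> u t x"
    and t: "t \<in> {0..T}"
  shows "AE x in lebesgue_on U. c \<le> u t x"
proof -
  let ?good = "\<lambda>r. AE x in lebesgue_on U. c \<le> u r x"
  have Linf: "u r \<in> Linf U" if "r \<in> {0..T}" for r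
    using W that unfolding W1inf_with_derivative_def by blast
  have lim: "((\<lambda>r. Linf_norm U (\<lambda>x. u r x - u t x)) \<longlongrightarrow> 0) (at t within {0..T})"
    using W t unfolding W1inf_with_derivative_def by blast
  have AE_good: "AE r in lebesgue_on {0..T}. ?good r"
    by (rule AE_lebesgue_on_Times[OF _ _ c]) (use U in auto)
  then have "AE r in lebesgue. r \<in> {0..T} \<longrightarrow> ?good r"
    by (subst (asm) AE_restrict_space_iff) auto
  then obtain N where N: "N \<in> null_sets lebesgue" "\<And>r. r \<in> {0..T} \<Longrightarrow> r \<notin> N \<Longrightarrow> ?good r"
    by (rule AE_E3) auto
  have "AE x in lebesgue_on U. c - 1 / real (Suc n) \<le> u t x" for n
  proof -
    have "\<forall>\<^sub>F r in at t within {0..T}. dist (Linf_norm U (\<lambda>x. u r x - u t x)) 0 < 1 / real (Suc n)"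
      using lim by (rule tendstoD) simp
    then obtain d where d: "d > 0" and close: "\<And>r. \<lbrakk>r \<in> {0..T}; r \<noteq> t; dist r t < d\<rbrakk> \<Longrightarrow>
        \<bar>Linf_norm U (\<lambda>x. u r x - u t x)\<bar> < 1 / real (Suc n)"
      unfolding eventually_at by auto
    \<comment> \<open>A one-sided window next to \<open>t\<close>, to the right unless
      \<open>t = T\<close>, so that it stays inside \<open>{0..T}\<close>. As a nonempty open set it
      is not null and hence contains a time outside the exceptional set \<open>N\<close>.\<close>
    define J where "J = (if t < T then {t<..<min T (t + d)} else {max 0 (t - d)<..<t})"
    have J: "open J" "J \<noteq> {}" "\<And>r. r \<in> J \<Longrightarrow> r \<in> {0..T} \<and> r \<noteq> t \<and> dist r t < d"
      using t T d by (auto simp: J_def dist_real_def split: if_splits)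
    have "\<not> negligible J"
      using J(1,2) by (rule open_not_negligible)
    then have "\<not> J \<subseteq> N"
      using N(1) negligible_subset by (auto simp: negligible_iff_null_sets)
    then obtain r where r: "r \<in> J" "?good r"
      using N(2) J(3) by blast
    with J(3) have rT: "r \<in> {0..T}" and small: "\<bar>Linf_norm U (\<lambda>x. u r x - u t x)\<bar> < 1 / real (Suc n)"
      using close by blast+
    have "AE x in lebesgue_on U. \<bar>u r x - u t x\<bar> \<le> Linf_norm U (\<lambda>x. u r x - u t x)"
      by (intro Linf_AE_bound Linf_diff Linf rT t)
    with r(2) show ?thesis
      by eventually_elim (use small in linarith)
  qed
  \<comment> \<open>Countably many exceptional sets in space have a null union, so the limit in
    \<open>n\<close> can be taken pointwise.\<close>
  then have "AE x in lebesgue_on U. \<forall>n. c - 1 / real (Suc n) \<le> u t x"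
    by (simp add: AE_all_countable)
  then show ?thesis
  proof eventually_elim
    case (elim x)
    have "(\<lambda>n. c - 1 / real (Suc n)) \<longlonglongrightarrow> c - 0"
      by (intro tendsto_diff tendsto_const LIMSEQ_Suc lim_1_over_n)
    then show ?case
      using elim LIMSEQ_le_const2[of "\<lambda>n. c - 1 / real (Suc n)"] by auto
  qed
qed

section \<open>Integrability and Lebesgue norms on bounded open sets\<close>

lemma continuous_closure_measurable:
  assumes "open U" "continuous_on (closure U) g"
  shows "g \<in> borel_measurable (lebesgue_on U)"
proof (rule continuous_imp_measurable_on_sets_lebesgue)
  show "continuous_on U g"
    using assms(2) closure_subset by (rule continuous_on_subset)
qed (use assms in auto)

text \<open>A function continuous on the compact closure is bounded, and \<open>U\<close> has finite
  measure. This supplies integrability for the discrete functions, with the porosity and the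
  Forchheimer coefficients as essentially bounded weights.\<close>

lemma integrable_Linf_mult_continuous:
  fixes U :: "'a::euclidean_space set"
  assumes U: "open U" "bounded U" and w: "w \<in> Linf U"
    and g: "continuous_on (closure U) (g :: 'a \<Rightarrow> real)"
  shows "integrable (lebesgue_on U) (\<lambda>x. w x * g x)"
proof -
  interpret finite_measure "lebesgue_on U"
    using U by (intro finite_measure_lebesgue_on lmeasurable_open)
  have "compact (g ` closure U)"
    using U g by (intro compact_continuous_image) (auto simp: compact_closure)
  then have "\<exists>B. \<forall>x\<in>closure U. \<bar>g x\<bar> \<le> B"
    by (auto dest!: compact_imp_bounded simp: bounded_iff)
  then obtain B where B: "\<And>x. x \<in> closure U \<Longrightarrow> \<bar>g x\<bar> \<le> B"
    by blast
  have meas: "(\<lambda>x. w x * g x) \<in> borel_measurable (lebesgue_on U)"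
    using U g w by (intro borel_measurable_times Linf_measurable continuous_closure_measurable)
  have "AE x in lebesgue_on U. x \<in> space (lebesgue_on U)"
    by (rule AE_space)
  with Linf_AE_bound[OF w]
  have "AE x in lebesgue_on U. norm (w x * g x) \<le> Linf_norm U w * B"
  proof eventually_elim
    case (elim x)
    then have "x \<in> closure U"
      using closure_subset by auto
    then show ?case
      using elim B[of x] by (simp add: abs_mult mult_mono')
  qed
  then show ?thesis
    using meas by (rule integrable_const_bound)
qed

lemma Linf_const: "(\<lambda>x. c) \<in> Linf U"
  by (rule Linf_I[where B = "\<bar>c\<bar>"]) auto

lemma integrable_continuous_closure:
  fixes U :: "'a::euclidean_space set"
  assumes U: "open U" "bounded U" and g: "continuous_on (closure U) (g :: 'a \<Rightarrow> real)"
  shows "integrable (lebesgue_on U) g"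
  using integrable_Linf_mult_continuous[OF U Linf_const[of 1] g] by simp

lemma continuous_on_norm_powr:
  fixes g :: "'a::euclidean_space \<Rightarrow> 'b::euclidean_space"
  assumes "continuous_on S g" "0 < p"
  shows "continuous_on S (\<lambda>x. norm (g x) powr p)"
  using assms by (intro continuous_on_powr' continuous_intros) auto

lemma continuous_closure_in_Lp:
  fixes g :: "'a::euclidean_space \<Rightarrow> 'b::euclidean_space"
  assumes "open U" "bounded U" "continuous_on (closure U) g" "0 < p"
  shows "g \<in> Lp p U"
  using assms unfolding Lp_def
  by (auto intro!: continuous_closure_measurable integrable_continuous_closure continuous_on_norm_powr)

lemma Lp_norm_powr:
  assumes "0 < p"
  shows "Lp_norm p U u powr p = (LINT x|lebesgue_on U. norm (u x) powr p)"
  unfolding Lp_norm_def using assms by (simp add: powr_powr)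

lemma Lp_norm_2_power2:
  "(Lp_norm 2 U u)\<^sup>2 = (LINT x|lebesgue_on U. (norm (u x))\<^sup>2)"
proof -
  have "(Lp_norm 2 U u)\<^sup>2 = Lp_norm 2 U u powr 2"
    by (simp add: Lp_norm_def powr_numeral)
  then show ?thesis
    by (simp add: Lp_norm_powr powr_numeral)
qed

lemma Lp_2_integrable: "u \<in> Lp 2 U \<Longrightarrow> integrable (lebesgue_on U) (\<lambda>x. (norm (u x))\<^sup>2)"
  by (simp add: Lp_def powr_numeral)

lemma Lp_2_I:
  assumes "u \<in> borel_measurable (lebesgue_on U)" "integrable (lebesgue_on U) (\<lambda>x. (norm (u x))\<^sup>2)"
  shows "u \<in> Lp 2 U"
  using assms by (simp add: Lp_def powr_numeral)

section \<open>Young's inequality for pairings and the projection bound\<close>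

text \<open>Young's inequality for \<open>c * b\<close> and \<open>a / c\<close> with
  \<open>c = \<epsilon> powr (1 / p)\<close>; the factors \<open>1 / p\<close> and
  \<open>1 / q\<close> are then bounded by one. The small parameter stands at \<open>b\<close>, the
  factor to be absorbed later.\<close>

lemma Young_powr_scaled:
  fixes a b p q \<epsilon> :: real
  assumes "1 < p" "1 < q" "1 / p + 1 / q = 1" "0 \<le> a" "0 \<le> b" "0 < \<epsilon>"
  shows "a * b \<le> \<epsilon> * b powr p + \<epsilon> powr (- q / p) * a powr q"
proof -
  define c where "c = \<epsilon> powr (1 / p)"
  have c: "0 < c" "c powr p = \<epsilon>" "c powr - q = \<epsilon> powr (- q / p)"
    using assms by (auto simp: c_def powr_powr)
  have "a * b = (c * b) * (a / c)"
    using c by simp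
  also have "\<dots> \<le> (c * b) powr p / p + (a / c) powr q / q"
    using assms c by (intro Youngs_inequality) auto
  also have "\<dots> \<le> (c * b) powr p + (a / c) powr q"
    using assms(1,2) by (intro add_mono) (simp_all add: divide_le_eq mult_le_cancel_left1)
  also have "(c * b) powr p = \<epsilon> * b powr p"
    using c assms by (simp add: powr_mult)
  also have "(a / c) powr q = c powr - q * a powr q"
    by (simp add: powr_divide powr_minus_divide)
  also have "c powr - q = \<epsilon> powr (- q / p)"
    by (rule c)
  finally show ?thesis .
qed

lemma pairing_commute: "pairing U u v = pairing U v u"
  by (simp add: pairing_def inner_commute)

text \<open>Young's inequality with parameter one gives the integrable majorant.\<close>

lemma pairing_integrable:
  fixes u v :: "'a::euclidean_space \<Rightarrow> 'b::euclidean_space"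
  assumes pq: "1 < p" "1 < q" "1 / p + 1 / q = 1" and u: "u \<in> Lp q U" and v: "v \<in> Lp p U"
  shows "integrable (lebesgue_on U) (\<lambda>x. u x \<bullet> v x)"
proof (rule Bochner_Integration.integrable_bound)
  show "integrable (lebesgue_on U) (\<lambda>x. norm (v x) powr p + norm (u x) powr q)"
    using u v by (simp add: Lp_def)
  show "(\<lambda>x. u x \<bullet> v x) \<in> borel_measurable (lebesgue_on U)"
    using u v by (intro borel_measurable_inner) (simp_all add: Lp_def)
  show "AE x in lebesgue_on U. norm (u x \<bullet> v x) \<le> norm (norm (v x) powr p + norm (u x) powr q)"
  proof (rule AE_I2)
    fix x
    have "norm (u x \<bullet> v x) \<le> norm (u x) * norm (v x)"
      by (simp add: Cauchy_Schwarz_ineq2)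
    also have "\<dots> \<le> norm (v x) powr p + norm (u x) powr q"
      using Young_powr_scaled[OF pq, of "norm (u x)" "norm (v x)" 1] by simp
    finally show "norm (u x \<bullet> v x) \<le> norm (norm (v x) powr p + norm (u x) powr q)"
      by simp
  qed
qed

text \<open>Integrating the pointwise inequality leads directly to powers of the norms, without a
  separate Hoelder inequality, in the additive form suited to absorption.\<close>

lemma pairing_Young:
  fixes u v :: "'a::euclidean_space \<Rightarrow> 'b::euclidean_space"
  assumes pq: "1 < p" "1 < q" "1 / p + 1 / q = 1" and u: "u \<in> Lp q U" and v: "v \<in> Lp p U"
    and \<epsilon>: "0 < \<epsilon>"
  shows "\<bar>pairing U u v\<bar> \<le>
    \<epsilon> * Lp_norm p U v powr p + \<epsilon> powr (- q / p) * Lp_norm q U u powr q"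
proof -
  have int: "integrable (lebesgue_on U) (\<lambda>x. norm (v x) powr p)"
      "integrable (lebesgue_on U) (\<lambda>x. norm (u x) powr q)"
    using u v by (simp_all add: Lp_def)
  have "\<bar>pairing U u v\<bar> \<le> (LINT x|lebesgue_on U. \<bar>u x \<bullet> v x\<bar>)"
    unfolding pairing_def by (rule integral_abs_bound)
  also have "\<dots> \<le> (LINT x|lebesgue_on U. \<epsilon> * norm (v x) powr p + \<epsilon> powr (- q / p) * norm (u x) powr q)"
  proof (rule integral_mono)
    show "integrable (lebesgue_on U) (\<lambda>x. \<bar>u x \<bullet> v x\<bar>)"
      using pairing_integrable[OF pq u v] by simp
    show "integrable (lebesgue_on U)
        (\<lambda>x. \<epsilon> * norm (v x) powr p + \<epsilon> powr (- q / p) * norm (u x) powr q)"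
      using int by simp
    show "\<bar>u x \<bullet> v x\<bar> \<le> \<epsilon> * norm (v x) powr p + \<epsilon> powr (- q / p) * norm (u x) powr q" for x
      using Young_powr_scaled[OF pq norm_ge_zero norm_ge_zero \<epsilon>, of "u x" "v x"]
        Cauchy_Schwarz_ineq2[of "u x" "v x"] by linarith
  qed
  also have "\<dots> = \<epsilon> * Lp_norm p U v powr p + \<epsilon> powr (- q / p) * Lp_norm q U u powr q"
    using int pq by (simp add: Lp_norm_powr)
  finally show ?thesis .
qed

lemma pairing_Young_2:
  fixes u v :: "'a::euclidean_space \<Rightarrow> 'b::euclidean_space"
  assumes "u \<in> Lp 2 U" "v \<in> Lp 2 U" "0 < \<epsilon>"
  shows "\<bar>pairing U u v\<bar> \<le> \<epsilon> * (Lp_norm 2 U v)\<^sup>2 + (Lp_norm 2 U u)\<^sup>2 / \<epsilon>"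
proof -
  have nonneg: "0 \<le> Lp_norm 2 U w" for w :: "'a \<Rightarrow> 'b"
    by (simp add: Lp_norm_def)
  show ?thesis
    using pairing_Young[of 2 2 u U v \<epsilon>] assms nonneg
    by (simp add: powr_numeral powr_minus field_simps)
qed

lemma Lp_2_diff:
  fixes u v :: "'a::euclidean_space \<Rightarrow> real"
  assumes u: "u \<in> Lp 2 U" and v: "v \<in> Lp 2 U"
  shows "(\<lambda>x. u x - v x) \<in> Lp 2 U"
proof (rule Lp_2_I)
  show "(\<lambda>x. u x - v x) \<in> borel_measurable (lebesgue_on U)"
    using u v by (intro borel_measurable_diff) (simp_all add: Lp_def)
  have eq: "(\<lambda>x. (norm (u x - v x))\<^sup>2) = (\<lambda>x. (norm (u x))\<^sup>2 - 2 * (u x \<bullet> v x) + (norm (v x))\<^sup>2)"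
    by (simp add: power2_eq_square algebra_simps)
  show "integrable (lebesgue_on U) (\<lambda>x. (norm (u x - v x))\<^sup>2)"
    unfolding eq using u v
    by (intro Bochner_Integration.integrable_add Bochner_Integration.integrable_diff
        integrable_mult_right Lp_2_integrable pairing_integrable[of 2 2]) simp_all
qed

text \<open>Testing orthogonality with \<open>w\<close> itself gives
  \<open>\<parallel>w\<parallel>^2 = (u, w)\<close>. Young with parameter \<open>1/2\<close> absorbs
  half of the left side; this produces the non-sharp factor 4, which only enters the final
  constant.\<close>

lemma L2_projection_bound:
  fixes \<Omega> :: "'a::euclidean_space set"
  assumes P: "is_L2_projection \<Omega> W u w" and u: "u \<in> Lp 2 \<Omega>" and w: "w \<in> Lp 2 \<Omega>"
  shows "(Lp_norm 2 \<Omega> w)\<^sup>2 \<le> 4 * (Lp_norm 2 \<Omega> u)\<^sup>2"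
proof -
  have "0 = pairing \<Omega> (\<lambda>x. u x - w x) w"
    using P by (simp add: is_L2_projection_def)
  also have "\<dots> = (LINT x|lebesgue_on \<Omega>. u x \<bullet> w x - w x \<bullet> w x)"
    by (simp add: pairing_def algebra_simps)
  also have "\<dots> = pairing \<Omega> u w - (LINT x|lebesgue_on \<Omega>. w x \<bullet> w x)"
    unfolding pairing_def using u w
    by (intro Bochner_Integration.integral_diff pairing_integrable[of 2 2]) simp_all
  also have "(LINT x|lebesgue_on \<Omega>. w x \<bullet> w x) = (Lp_norm 2 \<Omega> w)\<^sup>2"
    by (simp add: Lp_norm_2_power2) (simp add: power2_eq_square)
  finally have "(Lp_norm 2 \<Omega> w)\<^sup>2 = pairing \<Omega> u w"
    by simp
  with pairing_Young_2[OF u w, of "1 / 2"] show ?thesis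
    by simp
qed

section \<open>Coercivity of the Forchheimer term\<close>

lemma forchheimer_coercive:
  fixes \<Omega> :: "'a::euclidean_space set" and m :: "'a \<Rightarrow> 'a"
  assumes \<Omega>: "open \<Omega>" "bounded \<Omega>"
    and e: "\<And>i. i \<in> {-1..int N} \<Longrightarrow> -2 < e i"
    and Linf: "\<And>i. i \<in> {-1..int N} \<Longrightarrow> a i t \<in> Linf \<Omega>"
    and nonneg: "\<And>i. i \<in> {-1..int N} \<Longrightarrow> AE x in lebesgue_on \<Omega>. 0 \<le> a i t x"
    and c: "AE x in lebesgue_on \<Omega>. c \<le> a (int N) t x"
    and m: "continuous_on (closure \<Omega>) m"
  shows "c * Lp_norm (e (int N) + 2) \<Omega> m powr (e (int N) + 2) \<le>
    pairing \<Omega> (\<lambda>x. forchheimer N e a t x (norm (m x)) *\<^sub>R m x) m"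
proof -
  let ?g = "\<lambda>i x. a i t x * norm (m x) powr (e i + 2)"
  \<comment> \<open>Since \<open>0 powr p = 0\<close> for every \<open>p\<close>, both sides vanish
    at \<open>r = 0\<close>; zeros of \<open>m\<close> thus need no separate treatment even for
    negative exponents.\<close>
  have powr: "r powr p * (r * r) = r powr (p + 2)" if "0 \<le> r" for r p :: real
    using that by (cases "r = 0") (simp_all add: powr_add powr_numeral power2_eq_square)
  have cont: "continuous_on (closure \<Omega>) (\<lambda>x. norm (m x) powr (e i + 2))" if "i \<in> {-1..int N}" for i
    using m e[OF that] by (intro continuous_on_norm_powr) auto
  have eN: "-2 < e (int N)"
    by (rule e) simp
  have "(\<lambda>x. (forchheimer N e a t x (norm (m x)) *\<^sub>R m x) \<bullet> m x) = (\<lambda>x. \<Sum>i\<in>{-1..int N}. ?g i x)"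
    by (simp add: forchheimer_def sum_distrib_right mult.assoc powr dot_square_norm power2_eq_square)
  then have eq: "pairing \<Omega> (\<lambda>x. forchheimer N e a t x (norm (m x)) *\<^sub>R m x) m =
      (LINT x|lebesgue_on \<Omega>. (\<Sum>i\<in>{-1..int N}. ?g i x))"
    unfolding pairing_def by simp
  have "c * Lp_norm (e (int N) + 2) \<Omega> m powr (e (int N) + 2) =
      (LINT x|lebesgue_on \<Omega>. c * norm (m x) powr (e (int N) + 2))"
    using eN by (simp add: Lp_norm_powr)
  also have "\<dots> \<le> (LINT x|lebesgue_on \<Omega>. (\<Sum>i\<in>{-1..int N}. ?g i x))"
  proof (rule integral_mono_AE)
    show "integrable (lebesgue_on \<Omega>) (\<lambda>x. c * norm (m x) powr (e (int N) + 2))"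
      using cont[of "int N"]
      by (intro integrable_mult_right integrable_continuous_closure \<Omega>) simp
    show "integrable (lebesgue_on \<Omega>) (\<lambda>x. \<Sum>i\<in>{-1..int N}. ?g i x)"
      by (intro Bochner_Integration.integrable_sum integrable_Linf_mult_continuous \<Omega> Linf cont)
    have "AE x in lebesgue_on \<Omega>. \<forall>i\<in>{-1..int N}. 0 \<le> a i t x"
      using nonneg by (intro AE_finite_allI) auto
    with c show "AE x in lebesgue_on \<Omega>.
        c * norm (m x) powr (e (int N) + 2) \<le> (\<Sum>i\<in>{-1..int N}. ?g i x)"
    proof eventually_elim
      case (elim x)
      have "c * norm (m x) powr (e (int N) + 2) \<le> ?g (int N) x"
        using elim by (intro mult_right_mono) auto
      also have "\<dots> \<le> (\<Sum>i\<in>{-1..int N}. ?g i x)"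
        using elim by (intro member_le_sum) auto
      finally show ?case .
    qed
  qed
  finally show ?thesis
    by (simp add: eq)
qed

section \<open>Weighted energy and a single time step\<close>

text \<open>The porosity multiplies the difference quotient, so the quantity that telescopes in time
  is the weighted energy. These bounds translate between it and the plain norm.\<close>

lemma weighted_L2:
  fixes \<Omega> :: "'a::euclidean_space set" and \<phi> r :: "'a \<Rightarrow> real"
  assumes \<Omega>: "open \<Omega>" "bounded \<Omega>"
    and \<phi>: "\<phi> \<in> Linf \<Omega>" "\<And>x. x \<in> \<Omega> \<Longrightarrow> \<phi>_low \<le> \<phi> x \<and> \<phi> x \<le> K"
    and r: "continuous_on (closure \<Omega>) r"
  shows weighted_L2_integrable: "integrable (lebesgue_on \<Omega>) (\<lambda>x. \<phi> x * (r x)\<^sup>2)"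
    and weighted_L2_lower:
      "\<phi>_low * (Lp_norm 2 \<Omega> r)\<^sup>2 \<le> (LINT x|lebesgue_on \<Omega>. \<phi> x * (r x)\<^sup>2)"
    and weighted_L2_upper:
      "(LINT x|lebesgue_on \<Omega>. \<phi> x * (r x)\<^sup>2) \<le> K * (Lp_norm 2 \<Omega> r)\<^sup>2"
proof -
  show int: "integrable (lebesgue_on \<Omega>) (\<lambda>x. \<phi> x * (r x)\<^sup>2)"
    by (intro integrable_Linf_mult_continuous \<Omega> \<phi> continuous_intros r)
  have int_c: "integrable (lebesgue_on \<Omega>) (\<lambda>x. c * (r x)\<^sup>2)" for c
    by (intro integrable_mult_right integrable_continuous_closure \<Omega> continuous_intros r)
  have eq: "c * (Lp_norm 2 \<Omega> r)\<^sup>2 = (LINT x|lebesgue_on \<Omega>. c * (r x)\<^sup>2)" for c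
    by (simp add: Lp_norm_2_power2)
  show "\<phi>_low * (Lp_norm 2 \<Omega> r)\<^sup>2 \<le> (LINT x|lebesgue_on \<Omega>. \<phi> x * (r x)\<^sup>2)"
    unfolding eq using int int_c \<phi>(2) by (intro integral_mono) (auto intro!: mult_right_mono)
  show "(LINT x|lebesgue_on \<Omega>. \<phi> x * (r x)\<^sup>2) \<le> K * (Lp_norm 2 \<Omega> r)\<^sup>2"
    unfolding eq using int int_c \<phi>(2) by (intro integral_mono) (auto intro!: mult_right_mono)
qed

text \<open>\<open>A\<close> stands for the Forchheimer pairing, which enters only through
  \<open>flux\<close> and \<open>coercive\<close>. Half of the flux norm is spent on absorbing
  \<open>G\<close>; multiplication by \<open>2 * \<Delta>\<close> turns the remaining
  \<open>c / 2\<close> into \<open>c\<close>.\<close>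

lemma energy_step:
  fixes \<Omega> :: "'a::euclidean_space set" and m :: "'a \<Rightarrow> 'a" and \<phi> \<rho> \<rho>' f g :: "'a \<Rightarrow> real"
  defines "E \<equiv> \<lambda>r. LINT x|lebesgue_on \<Omega>. \<phi> x * (r x)\<^sup>2"
  assumes \<Omega>: "open \<Omega>" "bounded \<Omega>"
    and \<phi>: "\<phi> \<in> Linf \<Omega>" "\<And>x. x \<in> \<Omega> \<Longrightarrow> \<phi>_low \<le> \<phi> x \<and> \<phi> x \<le> K"
    and \<phi>_low: "0 < \<phi>_low" and \<Delta>: "0 < \<Delta>" and c: "0 < c"
    and s: "1 < s" "1 < s'" "1 / s + 1 / s' = 1"
    and \<rho>: "continuous_on (closure \<Omega>) \<rho>" and \<rho>': "continuous_on (closure \<Omega>) \<rho>'"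
    and m: "continuous_on (closure \<Omega>) m" and g: "continuous_on (closure \<Omega>) g"
    and f: "f \<in> Lp 2 \<Omega>" and G: "G \<in> Lp s' \<Omega>"
    and flux: "A - pairing \<Omega> \<rho> (divergence m) = - pairing \<Omega> G m"
    and coercive: "c * Lp_norm s \<Omega> m powr s \<le> A"
    and mass: "pairing \<Omega> (\<lambda>x. \<phi> x * ((\<rho> x - \<rho>' x) / \<Delta>)) \<rho> + pairing \<Omega> (divergence m) \<rho> =
      pairing \<Omega> f \<rho> - pairing \<Omega> (\<lambda>x. \<phi> x * g x) \<rho>"
  shows "E \<rho> + c * (\<Delta> * Lp_norm s \<Omega> m powr s) \<le> E \<rho>' + 4 / \<phi>_low * \<Delta> * E \<rho> +
    \<Delta> * (2 * (Lp_norm 2 \<Omega> f)\<^sup>2 + 2 * K\<^sup>2 * (Lp_norm 2 \<Omega> g)\<^sup>2 +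
      2 * (c / 2) powr (- s' / s) * Lp_norm s' \<Omega> G powr s')"
proof -
  have \<phi>_pos: "0 \<le> \<phi> x" if "x \<in> \<Omega>" for x
    using \<phi>(2)[OF that] \<phi>_low by linarith
  have \<phi>_sq_Linf: "(\<lambda>x. (\<phi> x)\<^sup>2) \<in> Linf \<Omega>"
    using Linf_measurable[OF \<phi>(1)] \<phi>(2) \<phi>_pos
    by (intro Linf_I[where B = "K\<^sup>2"] AE_I2) (auto intro!: power_mono)
  have E_int: "integrable (lebesgue_on \<Omega>) (\<lambda>x. \<phi> x * (r x)\<^sup>2)"
    if "continuous_on (closure \<Omega>) r" for r
    using weighted_L2_integrable[OF \<Omega> \<phi> that] .
  have L2: "\<rho> \<in> Lp 2 \<Omega>" "m \<in> Lp s \<Omega>" "g \<in> Lp 2 \<Omega>"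
    using s by (intro continuous_closure_in_Lp \<Omega> \<rho> m g; simp)+
  let ?R = "(Lp_norm 2 \<Omega> \<rho>)\<^sup>2"
  have \<phi>g_sq: "(\<lambda>x. (\<phi> x * g x)\<^sup>2) = (\<lambda>x. (\<phi> x)\<^sup>2 * (g x)\<^sup>2)"
    by (simp add: power_mult_distrib)
  have \<phi>g_int: "integrable (lebesgue_on \<Omega>) (\<lambda>x. (\<phi> x * g x)\<^sup>2)"
    unfolding \<phi>g_sq by (intro integrable_Linf_mult_continuous \<Omega> \<phi>_sq_Linf continuous_intros g)
  have \<phi>g: "(\<lambda>x. \<phi> x * g x) \<in> Lp 2 \<Omega>"
    using \<phi>g_int
    by (intro Lp_2_I borel_measurable_times Linf_measurable[OF \<phi>(1)] continuous_closure_measurable \<Omega> g) simp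
  have "(Lp_norm 2 \<Omega> (\<lambda>x. \<phi> x * g x))\<^sup>2 \<le> (LINT x|lebesgue_on \<Omega>. K\<^sup>2 * (norm (g x))\<^sup>2)"
    unfolding Lp_norm_2_power2
  proof (rule integral_mono)
    show "integrable (lebesgue_on \<Omega>) (\<lambda>x. (norm (\<phi> x * g x))\<^sup>2)"
      using \<phi>g_int by simp
    show "integrable (lebesgue_on \<Omega>) (\<lambda>x. K\<^sup>2 * (norm (g x))\<^sup>2)"
      by (intro integrable_mult_right Lp_2_integrable L2)
    show "(norm (\<phi> x * g x))\<^sup>2 \<le> K\<^sup>2 * (norm (g x))\<^sup>2" if "x \<in> space (lebesgue_on \<Omega>)" for x
      using \<phi>(2)[of x] \<phi>_low that by (auto simp: power_mult_distrib intro!: mult_right_mono power_mono)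
  qed
  then have \<phi>g_le: "(Lp_norm 2 \<Omega> (\<lambda>x. \<phi> x * g x))\<^sup>2 \<le> K\<^sup>2 * (Lp_norm 2 \<Omega> g)\<^sup>2"
    by (simp add: Lp_norm_2_power2)
  have R: "?R \<le> E \<rho> / \<phi>_low"
    using weighted_L2_lower[OF \<Omega> \<phi> \<rho>] \<phi>_low by (simp add: E_def field_simps)
  \<comment> \<open>Pointwise, \<open>(r - r') r = (r^2 - r'^2 + (r - r')^2) / 2\<close>. The last
    square, the numerical dissipation of implicit Euler, is nonnegative and is discarded.\<close>
  have "(E \<rho> - E \<rho>') / (2 * \<Delta>) = (LINT x|lebesgue_on \<Omega>. (\<phi> x * (\<rho> x)\<^sup>2 - \<phi> x * (\<rho>' x)\<^sup>2) / (2 * \<Delta>))"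
    unfolding E_def using E_int[OF \<rho>] E_int[OF \<rho>'] by simp
  also have "\<dots> \<le> pairing \<Omega> (\<lambda>x. \<phi> x * ((\<rho> x - \<rho>' x) / \<Delta>)) \<rho>"
    unfolding pairing_def
  proof (rule integral_mono)
    show "integrable (lebesgue_on \<Omega>) (\<lambda>x. (\<phi> x * (\<rho> x)\<^sup>2 - \<phi> x * (\<rho>' x)\<^sup>2) / (2 * \<Delta>))"
      using E_int[OF \<rho>] E_int[OF \<rho>'] by simp
    have "integrable (lebesgue_on \<Omega>) (\<lambda>x. \<phi> x * ((\<rho> x - \<rho>' x) / \<Delta> * \<rho> x))"
      using \<Delta> by (intro integrable_Linf_mult_continuous \<Omega> \<phi>(1) continuous_intros \<rho> \<rho>') auto
    then show "integrable (lebesgue_on \<Omega>) (\<lambda>x. (\<phi> x * ((\<rho> x - \<rho>' x) / \<Delta>)) \<bullet> \<rho> x)"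
      by (simp add: mult.assoc)
    fix x assume "x \<in> space (lebesgue_on \<Omega>)"
    then have "0 \<le> \<phi> x"
      using \<phi>(2)[of x] \<phi>_low by auto
    then have "0 \<le> \<phi> x * (\<rho> x - \<rho>' x)\<^sup>2 / (2 * \<Delta>)"
      using \<Delta> by simp
    also have "\<dots> = (\<phi> x * ((\<rho> x - \<rho>' x) / \<Delta>)) * \<rho> x - (\<phi> x * (\<rho> x)\<^sup>2 - \<phi> x * (\<rho>' x)\<^sup>2) / (2 * \<Delta>)"
      using \<Delta> by (simp add: field_simps power2_eq_square)
    finally show "(\<phi> x * (\<rho> x)\<^sup>2 - \<phi> x * (\<rho>' x)\<^sup>2) / (2 * \<Delta>) \<le> (\<phi> x * ((\<rho> x - \<rho>' x) / \<Delta>)) \<bullet> \<rho> x"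
      by simp
  qed
  finally have time: "(E \<rho> - E \<rho>') / (2 * \<Delta>) \<le> pairing \<Omega> (\<lambda>x. \<phi> x * ((\<rho> x - \<rho>' x) / \<Delta>)) \<rho>" .
  have "(E \<rho> - E \<rho>') / (2 * \<Delta>) + c * Lp_norm s \<Omega> m powr s \<le>
      pairing \<Omega> f \<rho> - pairing \<Omega> (\<lambda>x. \<phi> x * g x) \<rho> - pairing \<Omega> G m"
    using time coercive flux mass pairing_commute[of \<Omega> \<rho> "divergence m"] by linarith
  \<comment> \<open>The two scalar pairings use parameter 1 and cost one \<open>?R\<close> each, the
    flux pairing uses \<open>c / 2\<close>. With \<open>R\<close> and the later doubling, the two
    copies of \<open>?R\<close> become the coefficient \<open>4 / \<phi>_low\<close>.\<close>
  also have "\<dots> \<le> (?R + (Lp_norm 2 \<Omega> f)\<^sup>2) + (?R + K\<^sup>2 * (Lp_norm 2 \<Omega> g)\<^sup>2) +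
      (c / 2 * Lp_norm s \<Omega> m powr s + (c / 2) powr (- s' / s) * Lp_norm s' \<Omega> G powr s')"
    using pairing_Young_2[OF f L2(1), of 1] pairing_Young_2[OF \<phi>g L2(1), of 1] \<phi>g_le
      pairing_Young[OF s G L2(2), of "c / 2"] c by simp
  finally have "(E \<rho> - E \<rho>') / (2 * \<Delta>) \<le> 2 * (E \<rho> / \<phi>_low) - c / 2 * Lp_norm s \<Omega> m powr s +
      ((Lp_norm 2 \<Omega> f)\<^sup>2 + K\<^sup>2 * (Lp_norm 2 \<Omega> g)\<^sup>2 + (c / 2) powr (- s' / s) * Lp_norm s' \<Omega> G powr s')"
    using R by linarith
  then have "(E \<rho> - E \<rho>') \<le> (2 * (E \<rho> / \<phi>_low) - c / 2 * Lp_norm s \<Omega> m powr s +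
      ((Lp_norm 2 \<Omega> f)\<^sup>2 + K\<^sup>2 * (Lp_norm 2 \<Omega> g)\<^sup>2 + (c / 2) powr (- s' / s) * Lp_norm s' \<Omega> G powr s')) * (2 * \<Delta>)"
    using \<Delta> by (simp add: pos_divide_le_eq)
  then show ?thesis
    by (simp add: algebra_simps)
qed

section \<open>The implicit discrete Gronwall inequality\<close>

text \<open>Each step costs a factor \<open>1 / (1 - x)\<close> with
  \<open>x = \<mu> * \<Delta>\<close>, which is at most \<open>exp (2 * x)\<close> because
  \<open>x \<le> 1 / 2\<close>. The accumulated dissipation is carried along in the induction, so
  both quantities are bounded together.\<close>

lemma discrete_gronwall:
  fixes E m D :: "nat \<Rightarrow> real"
  assumes nonneg: "\<And>n. 0 \<le> E n" "\<And>n. 0 \<le> m n" "\<And>n. 0 \<le> D n"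
    and \<Delta>: "0 \<le> \<Delta>" and \<mu>: "0 \<le> \<mu>" and b: "0 \<le> b" and small: "\<mu> * \<Delta> \<le> 1 / 2"
    and step: "\<And>n. n \<in> {1..M} \<Longrightarrow> E n + b * (\<Delta> * m n) \<le> E (n - 1) + \<mu> * \<Delta> * E n + \<Delta> * D n"
    and n: "n \<le> M"
  shows "E n + b * (\<Sum>i=1..n. \<Delta> * m i) \<le>
    exp (2 * \<mu> * (real n * \<Delta>)) * (E 0 + (\<Sum>i=1..n. \<Delta> * D i))"
  using n
proof (induction n)
  case 0
  show ?case by simp
next
  case (Suc n)
  define x where "x = \<mu> * \<Delta>"
  have x: "0 \<le> x" "x \<le> 1 / 2"
    using \<mu> \<Delta> small by (simp_all add: x_def)
  let ?S = "\<lambda>n. E n + b * (\<Sum>i=1..n. \<Delta> * m i)"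
  let ?R = "E 0 + (\<Sum>i=1..n. \<Delta> * D i)"
  have sum_nonneg: "0 \<le> (\<Sum>i=1..k. \<Delta> * m i)" for k
    using nonneg \<Delta> by (intro sum_nonneg) auto
  have S_nonneg: "0 \<le> ?S (Suc n)"
    using nonneg b sum_nonneg by (intro add_nonneg_nonneg mult_nonneg_nonneg)
  \<comment> \<open>Enlarging the implicit term to the whole of \<open>?S\<close> allows it to be
    moved to the left as a factor \<open>1 - x\<close>.\<close>
  have "x * E (Suc n) \<le> x * ?S (Suc n)"
    using x b sum_nonneg[of "Suc n"] by (intro mult_left_mono) auto
  with step[of "Suc n"] Suc.prems
  have "?S (Suc n) \<le> ?S n + x * ?S (Suc n) + \<Delta> * D (Suc n)"
    by (simp add: x_def algebra_simps)
  then have "(1 - x) * ?S (Suc n) \<le> ?S n + \<Delta> * D (Suc n)"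
    by (simp add: algebra_simps)
  also have "\<dots> \<le> exp (2 * \<mu> * (real n * \<Delta>)) * ?R + exp (2 * \<mu> * (real n * \<Delta>)) * (\<Delta> * D (Suc n))"
  proof (intro add_mono)
    show "\<Delta> * D (Suc n) \<le> exp (2 * \<mu> * (real n * \<Delta>)) * (\<Delta> * D (Suc n))"
      using \<mu> \<Delta> nonneg(3)[of "Suc n"] by (simp add: mult_le_cancel_right1 mult_less_0_iff not_less)
  qed (use Suc in simp)
  finally have S: "(1 - x) * ?S (Suc n) \<le> exp (2 * \<mu> * (real n * \<Delta>)) * (?R + \<Delta> * D (Suc n))"
    by (simp add: algebra_simps)
  \<comment> \<open>The product \<open>(1 + 2x)(1 - x)\<close> equals \<open>1 + x - 2x^2\<close>,
    which is at least 1 exactly when \<open>x^2 \<le> x / 2\<close>.\<close>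
  have "x * x \<le> x * (1 / 2)"
    using x by (intro mult_left_mono) auto
  then have "1 \<le> (1 + 2 * x) * (1 - x)"
    by (simp add: algebra_simps)
  also have "\<dots> \<le> exp (2 * x) * (1 - x)"
    using x exp_ge_add_one_self[of "2 * x"] by (intro mult_right_mono) auto
  finally have "1 * ?S (Suc n) \<le> exp (2 * x) * (1 - x) * ?S (Suc n)"
    using S_nonneg by (rule mult_right_mono)
  also have "\<dots> \<le> exp (2 * x) * (exp (2 * \<mu> * (real n * \<Delta>)) * (?R + \<Delta> * D (Suc n)))"
    using S by (simp add: mult.assoc)
  also have "\<dots> = exp (2 * \<mu> * (real (Suc n) * \<Delta>)) * (E 0 + (\<Sum>i=1..Suc n. \<Delta> * D i))"
    by (simp add: x_def algebra_simps flip: exp_add)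
  finally show ?case by simp
qed

section \<open>Choice of constants and summation over the time steps\<close>

theorem lemma7p1:
  fixes \<Omega> :: "'a::euclidean_space set"
    and T \<alpha> a_low a_up b_up \<phi>_low \<phi>_up s s' :: real
    and N :: nat
    and e :: "int \<Rightarrow> real"
    and a a' :: "int \<Rightarrow> real \<Rightarrow> 'a \<Rightarrow> real"
  assumes dim: "2 \<le> DIM('a)"
    and \<Omega>: "open \<Omega>" "bounded \<Omega>" "C1_boundary \<Omega>"
    and T: "0 < T"
    and N: "1 \<le> N"
    and exponents: "0 < \<alpha>" "\<alpha> < 1" "e (-1) = - \<alpha>" "e 0 = 0" "strict_mono_on {-1..int N} e"
    and s: "s = e (int N) + 2" "s' = s / (s - 1)"
    and coeff_space: "\<And>i. i \<in> {-1..int N} \<Longrightarrow> W1inf_with_derivative T \<Omega> (a i) (a' i)"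
    and a_low: "0 < a_low"
    and coeff_outer: "\<And>i. i \<in> {-1, 0, int N} \<Longrightarrow>
          AE (t, x) in lebesgue_on ({0..T} \<times> \<Omega>). a_low < a i t x \<and> a i t x < a_up"
    and coeff_inner: "\<And>i. i \<in> {1..int N - 1} \<Longrightarrow>
          AE (t, x) in lebesgue_on ({0..T} \<times> \<Omega>). 0 \<le> a i t x \<and> a i t x \<le> a_up"
    and coeff_deriv: "\<And>i. i \<in> {-1..int N} \<Longrightarrow>
          AE (t, x) in lebesgue_on ({0..T} \<times> \<Omega>). \<bar>a' i t x\<bar> < b_up"
    and \<phi>_low: "0 < \<phi>_low"
  shows "\<exists>C>0. \<exists>\<delta>>0.
    \<forall>(\<phi> :: 'a \<Rightarrow> real) (f :: real \<Rightarrow> 'a \<Rightarrow> real)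
     (\<psi> :: real \<Rightarrow> 'a \<Rightarrow> real) (\<Psi> :: real \<Rightarrow> 'a \<Rightarrow> real)
     (\<Psi>t :: real \<Rightarrow> 'a \<Rightarrow> real) (grad\<Psi> :: real \<Rightarrow> 'a \<Rightarrow> 'a)
     (\<rho>0 :: 'a \<Rightarrow> real) (\<rho>0bar :: 'a \<Rightarrow> real)
     (H :: real set) (\<T> :: real \<Rightarrow> 'a set set) (h :: real) (k :: nat)
     (M :: nat) (\<Delta> :: real) (m :: nat \<Rightarrow> 'a \<Rightarrow> 'a) (\<rho> :: nat \<Rightarrow> 'a \<Rightarrow> real).
      \<phi> \<in> borel_measurable (lebesgue_on \<Omega>) \<and> (\<forall>x\<in>\<Omega>. \<phi>_low \<le> \<phi> x \<and> \<phi> x \<le> \<phi>_up) \<and>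
      f \<in> Linf_Bochner T (Lp 2 \<Omega>) (Lp_norm 2 \<Omega>) \<and>
      C12 T \<Omega> \<psi> \<and>
      (\<forall>t\<in>{0..T}. \<forall>x\<in>frontier \<Omega>. \<Psi> t x = \<psi> t x) \<and>
      (\<forall>t\<in>{0..T}. \<forall>x\<in>closure \<Omega>.
         ((\<lambda>r. \<Psi> r x) has_real_derivative \<Psi>t t x) (at t within {0..T})) \<and>
      \<rho>0 \<in> Lp 2 \<Omega> \<and> \<rho>0bar = (\<lambda>x. \<rho>0 x - \<Psi> 0 x) \<and>
      quasi_uniform_triangulations \<Omega> H \<T> \<and> h \<in> H \<and>
      1 \<le> M \<and> \<Delta> = T / real M \<and> \<Delta> < \<delta> \<and>
      (\<forall>n\<in>{0..M}. continuous_on (closure \<Omega>) (\<Psi> (real n * \<Delta>)) \<and>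
                  continuous_on (closure \<Omega>) (\<Psi>t (real n * \<Delta>))) \<and>
      (\<forall>n\<in>{1..M}. f (real n * \<Delta>) \<in> Lp 2 \<Omega> \<and>
                  weak_gradient \<Omega> (\<Psi> (real n * \<Delta>)) (grad\<Psi> (real n * \<Delta>)) \<and>
                  grad\<Psi> (real n * \<Delta>) \<in> Lp s' \<Omega>) \<and>
      is_L2_projection \<Omega> (Qh k \<Omega> (\<T> h)) \<rho>0bar (\<rho> 0) \<and>
      (\<forall>n\<in>{1..M}. m n \<in> Vh k \<Omega> (\<T> h) \<and> \<rho> n \<in> Qh k \<Omega> (\<T> h) \<and>
         scheme_step N e a \<Omega> (Vh k \<Omega> (\<T> h)) (Qh k \<Omega> (\<T> h)) \<phi> f \<Psi>t grad\<Psi> \<Delta> m \<rho> n)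
      \<longrightarrow>
      (\<forall>n\<in>{1..M}.
         (Lp_norm 2 \<Omega> (\<rho> n))\<^sup>2 + (\<Sum>i=1..n. \<Delta> * Lp_norm s \<Omega> (m i) powr s)
         \<le> C * ((Lp_norm 2 \<Omega> \<rho>0bar)\<^sup>2 +
                (\<Sum>i=1..n. \<Delta> * ((Lp_norm 2 \<Omega> (f (real i * \<Delta>)))\<^sup>2 +
                                  (Lp_norm 2 \<Omega> (\<Psi>t (real i * \<Delta>)))\<^sup>2 +
                                  Lp_norm s' \<Omega> (grad\<Psi> (real i * \<Delta>)) powr s'))))"
proof -
  have eN: "0 < e (int N)"
    using exponents(4,5) N strict_mono_onD[of "{-1..int N}" e 0 "int N"] by auto
  have e_gt: "-2 < e i" if "i \<in> {-1..int N}" for i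
  proof (cases "i = -1")
    case False
    then show ?thesis
      using exponents that strict_mono_onD[of "{-1..int N}" e "-1" i] by auto
  qed (use exponents in simp)
  have s_gt: "1 < s"
    using eN s(1) by simp
  then have s'_gt: "1 < s'" and s_conj: "1 / s + 1 / s' = 1"
    by (simp_all add: s(2) field_simps)
  \<comment> \<open>The sign of \<open>\<phi>_up\<close> is not prescribed; the maximum is positive
    and still bounds the porosity from above.\<close>
  define K where "K = max \<phi>_low \<phi>_up"
  define \<mu> where "\<mu> = 4 / \<phi>_low"
  \<comment> \<open>\<open>\<kappa>\<close> dominates the three data coefficients of
    \<open>energy_step\<close>; \<open>B\<close> also covers the factor \<open>4 * K\<close> from
    the projected initial datum. In \<open>C\<close>, the exponential is the Gronwall factor up to
    time \<open>T\<close>, and the reciprocals return from the energy to the two norms. Only fixed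
    parameters enter, neither mesh nor data.\<close>
  define \<kappa> where "\<kappa> = 2 + 2 * K\<^sup>2 + 2 * (a_low / 2) powr (- s' / s)"
  define B where "B = 4 * K + \<kappa>"
  define C where "C = (1 / \<phi>_low + 1 / a_low) * (exp (2 * \<mu> * T) * B)"
  have K: "0 < K" and \<mu>: "0 < \<mu>" and \<kappa>: "0 < \<kappa>"
    using \<phi>_low by (auto simp: K_def \<mu>_def \<kappa>_def intro!: add_pos_nonneg)
  then have B: "0 < B" "4 * K \<le> B" "\<kappa> \<le> B"
    by (simp_all add: B_def)
  then have C: "0 < C"
    using \<phi>_low a_low by (simp add: C_def add_pos_pos)
  \<comment> \<open>This threshold makes \<open>\<mu> * \<Delta> = 4 * \<Delta> / \<phi>_low\<close>
    less than \<open>1 / 2\<close>, as the Gronwall step demands.\<close>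
  have \<delta>: "0 < \<phi>_low / 8"
    using \<phi>_low by simp
  have coeff_Linf: "a i t \<in> Linf \<Omega>" if "i \<in> {-1..int N}" "t \<in> {0..T}" for i t
    using coeff_space[OF that(1)] that(2) unfolding W1inf_with_derivative_def by blast
  \<comment> \<open>The scheme evaluates coefficients at single times, a null set in time, while the
    bounds hold only almost everywhere in space-time; the continuous representative bridges the
    gap.\<close>
  have coeff_nonneg: "AE x in lebesgue_on \<Omega>. 0 \<le> a i t x" if i: "i \<in> {-1..int N}" and t: "t \<in> {0..T}" for i t
  proof (rule W1inf_lower_bound[OF coeff_space[OF i] \<Omega>(1) T _ t])
    consider "i \<in> {-1, 0, int N}" | "i \<in> {1..int N - 1}"
      using i by fastforce
    then show "AE (t, x) in lebesgue_on ({0..T} \<times> \<Omega>). 0 \<le> a i t x"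
    proof cases
      case 1
      from coeff_outer[OF this] show ?thesis
        by eventually_elim (use a_low in auto)
    next
      case 2
      from coeff_inner[OF this] show ?thesis
        by eventually_elim auto
    qed
  qed
  have coeff_top: "AE x in lebesgue_on \<Omega>. a_low \<le> a (int N) t x" if "t \<in> {0..T}" for t
  proof (rule W1inf_lower_bound[OF coeff_space \<Omega>(1) T _ that])
    have "AE (t, x) in lebesgue_on ({0..T} \<times> \<Omega>). a_low < a (int N) t x \<and> a (int N) t x < a_up"
      by (rule coeff_outer) simp
    then show "AE (t, x) in lebesgue_on ({0..T} \<times> \<Omega>). a_low \<le> a (int N) t x"
      by eventually_elim auto
  qed simp
  show ?thesis
  proof (rule exI[of _ C], rule conjI[OF C], rule exI[of _ "\<phi>_low / 8"], rule conjI[OF \<delta>],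
      intro allI impI ballI, elim conjE)
    fix \<phi> :: "'a \<Rightarrow> real" and f :: "real \<Rightarrow> 'a \<Rightarrow> real"
      and \<psi> \<Psi> \<Psi>t :: "real \<Rightarrow> 'a \<Rightarrow> real" and grad\<Psi> :: "real \<Rightarrow> 'a \<Rightarrow> 'a"
      and \<rho>0 \<rho>0bar :: "'a \<Rightarrow> real" and H :: "real set" and \<T> :: "real \<Rightarrow> 'a set set"
      and h :: real and k M :: nat and \<Delta> :: real
      and m :: "nat \<Rightarrow> 'a \<Rightarrow> 'a" and \<rho> :: "nat \<Rightarrow> 'a \<Rightarrow> real" and n :: nat
    let ?V = "Vh k \<Omega> (\<T> h)" and ?Q = "Qh k \<Omega> (\<T> h)"
    assume n: "n \<in> {1..M}"
      and \<phi>_meas: "\<phi> \<in> borel_measurable (lebesgue_on \<Omega>)"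
      and \<phi>_bds: "\<forall>x\<in>\<Omega>. \<phi>_low \<le> \<phi> x \<and> \<phi> x \<le> \<phi>_up"
      and \<rho>0: "\<rho>0 \<in> Lp 2 \<Omega>" and \<rho>0bar: "\<rho>0bar = (\<lambda>x. \<rho>0 x - \<Psi> 0 x)"
      and M: "1 \<le> M" and \<Delta>_eq: "\<Delta> = T / real M" and \<Delta>_small: "\<Delta> < \<phi>_low / 8"
      and \<Psi>_cont: "\<forall>n\<in>{0..M}. continuous_on (closure \<Omega>) (\<Psi> (real n * \<Delta>)) \<and>
        continuous_on (closure \<Omega>) (\<Psi>t (real n * \<Delta>))"
      and data: "\<forall>n\<in>{1..M}. f (real n * \<Delta>) \<in> Lp 2 \<Omega> \<and>
        weak_gradient \<Omega> (\<Psi> (real n * \<Delta>)) (grad\<Psi> (real n * \<Delta>)) \<and>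
        grad\<Psi> (real n * \<Delta>) \<in> Lp s' \<Omega>"
      and proj: "is_L2_projection \<Omega> ?Q \<rho>0bar (\<rho> 0)"
      and scheme: "\<forall>n\<in>{1..M}. m n \<in> ?V \<and> \<rho> n \<in> ?Q \<and>
        scheme_step N e a \<Omega> ?V ?Q \<phi> f \<Psi>t grad\<Psi> \<Delta> m \<rho> n"
    have \<Delta>: "0 < \<Delta>"
      using T M by (simp add: \<Delta>_eq)
    have time_le: "real i * \<Delta> \<le> T" if "i \<le> M" for i
      using that T M by (simp add: \<Delta>_eq field_simps)
    have \<phi>: "\<phi>_low \<le> \<phi> x \<and> \<phi> x \<le> K" if "x \<in> \<Omega>" for x
      using \<phi>_bds that by (force simp: K_def)
    \<comment> \<open>Index 0 is covered by the projection and not by the scheme; the first time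
      step needs it as the previous density.\<close>
    have \<rho>_in: "\<rho> i \<in> ?Q" if "i \<le> M" for i
      using that proj scheme by (cases "i = 0") (auto simp: is_L2_projection_def)
    have \<rho>_cont: "continuous_on (closure \<Omega>) (\<rho> i)" if "i \<le> M" for i
      using \<rho>_in[OF that] by (simp add: Qh_def)
    have m_cont: "continuous_on (closure \<Omega>) (m i)" if "i \<in> {1..M}" for i
      using scheme that by (simp add: Vh_def)
    define E where "E i = (LINT x|lebesgue_on \<Omega>. \<phi> x * (\<rho> i x)\<^sup>2)" for i
    define m_pow where "m_pow i = Lp_norm s \<Omega> (m i) powr s" for i
    define D where "D i = (Lp_norm 2 \<Omega> (f (real i * \<Delta>)))\<^sup>2 +
      (Lp_norm 2 \<Omega> (\<Psi>t (real i * \<Delta>)))\<^sup>2 + Lp_norm s' \<Omega> (grad\<Psi> (real i * \<Delta>)) powr s'" for i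
    define R where "R = (Lp_norm 2 \<Omega> \<rho>0bar)\<^sup>2"
    have D: "0 \<le> D i" for i
      by (simp add: D_def)
    have \<phi>_nonneg: "0 \<le> \<phi> x" if "x \<in> \<Omega>" for x
      using \<phi>[OF that] \<phi>_low by linarith
    have E: "0 \<le> E i" for i
      unfolding E_def by (rule integral_nonneg_AE, rule AE_I2) (simp add: \<phi>_nonneg)
    have \<phi>_Linf: "\<phi> \<in> Linf \<Omega>"
      using \<phi>_meas \<phi> \<phi>_nonneg by (intro Linf_I[where B = K] AE_I2) auto
    have \<rho>_le: "(Lp_norm 2 \<Omega> (\<rho> i))\<^sup>2 \<le> E i / \<phi>_low" if "i \<le> M" for i
      using weighted_L2_lower[OF \<Omega>(1,2) \<phi>_Linf \<phi> \<rho>_cont[OF that]] \<phi>_low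
      by (simp add: E_def field_simps)
    have "\<rho>0bar \<in> Lp 2 \<Omega>"
    proof -
      have "continuous_on (closure \<Omega>) (\<Psi> 0)"
        using \<Psi>_cont by force
      then have "\<Psi> 0 \<in> Lp 2 \<Omega>"
        by (intro continuous_closure_in_Lp \<Omega>(1,2)) auto
      with \<rho>0 show ?thesis
        unfolding \<rho>0bar by (rule Lp_2_diff)
    qed
    then have "(Lp_norm 2 \<Omega> (\<rho> 0))\<^sup>2 \<le> 4 * R"
      unfolding R_def
      by (rule L2_projection_bound[OF proj])
        (intro continuous_closure_in_Lp \<Omega>(1,2) \<rho>_cont; simp)
    then have "K * (Lp_norm 2 \<Omega> (\<rho> 0))\<^sup>2 \<le> K * (4 * R)"
      using K by (intro mult_left_mono) auto
    moreover have "E 0 \<le> K * (Lp_norm 2 \<Omega> (\<rho> 0))\<^sup>2"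
      unfolding E_def by (rule weighted_L2_upper[OF \<Omega>(1,2) \<phi>_Linf \<phi> \<rho>_cont]) simp_all
    ultimately have E0: "E 0 \<le> 4 * K * R"
      by simp
    have step: "E i + a_low * (\<Delta> * m_pow i) \<le> E (i - 1) + \<mu> * \<Delta> * E i + \<Delta> * (\<kappa> * D i)"
      if i: "i \<in> {1..M}" for i
    proof -
      let ?t = "real i * \<Delta>"
      let ?A = "pairing \<Omega> (\<lambda>x. forchheimer N e a ?t x (norm (m i x)) *\<^sub>R m i x) (m i)"
      have t: "?t \<in> {0..T}"
        using i \<Delta> time_le[of i] by simp
      have iM: "i \<le> M" "i - 1 \<le> M"
        using i by auto
      have fi: "f ?t \<in> Lp 2 \<Omega>" and gi: "grad\<Psi> ?t \<in> Lp s' \<Omega>" and \<Psi>i: "continuous_on (closure \<Omega>) (\<Psi>t ?t)"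
        using data \<Psi>_cont i by auto
      have mi: "m i \<in> ?V" and ri: "\<rho> i \<in> ?Q"
        and sch: "scheme_step N e a \<Omega> ?V ?Q \<phi> f \<Psi>t grad\<Psi> \<Delta> m \<rho> i"
        using scheme i by auto
      have flux: "?A - pairing \<Omega> (\<rho> i) (divergence (m i)) = - pairing \<Omega> (grad\<Psi> ?t) (m i)"
        using sch mi by (simp add: scheme_step_def Let_def)
      have mass: "pairing \<Omega> (\<lambda>x. \<phi> x * ((\<rho> i x - \<rho> (i - 1) x) / \<Delta>)) (\<rho> i) +
          pairing \<Omega> (divergence (m i)) (\<rho> i) =
          pairing \<Omega> (f ?t) (\<rho> i) - pairing \<Omega> (\<lambda>x. \<phi> x * \<Psi>t ?t x) (\<rho> i)"
        using sch ri by (simp add: scheme_step_def Let_def)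
      have coercive: "a_low * Lp_norm s \<Omega> (m i) powr s \<le> ?A"
        unfolding s(1)
        by (intro forchheimer_coercive \<Omega>(1,2) e_gt coeff_Linf coeff_nonneg coeff_top t m_cont i)
      let ?f = "(Lp_norm 2 \<Omega> (f ?t))\<^sup>2" and ?g = "(Lp_norm 2 \<Omega> (\<Psi>t ?t))\<^sup>2"
        and ?G = "Lp_norm s' \<Omega> (grad\<Psi> ?t) powr s'" and ?c = "(a_low / 2) powr (- s' / s)"
      have "E i + a_low * (\<Delta> * m_pow i) \<le> E (i - 1) + \<mu> * \<Delta> * E i +
          \<Delta> * (2 * ?f + 2 * K\<^sup>2 * ?g + 2 * ?c * ?G)"
        unfolding E_def m_pow_def \<mu>_def
        by (rule energy_step[OF \<Omega>(1,2) \<phi>_Linf \<phi> \<phi>_low \<Delta> a_low s_gt s'_gt s_conj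
              \<rho>_cont[OF iM(1)] \<rho>_cont[OF iM(2)] m_cont[OF i] \<Psi>i fi gi flux coercive mass])
      also have "2 * ?f + 2 * K\<^sup>2 * ?g + 2 * ?c * ?G \<le> \<kappa> * ?f + \<kappa> * ?g + \<kappa> * ?G"
        by (intro add_mono mult_right_mono) (auto simp: \<kappa>_def)
      also have "\<dots> = \<kappa> * D i"
        by (simp add: D_def algebra_simps)
      finally show ?thesis
        using \<Delta> by simp
    qed
    have "E n + a_low * (\<Sum>i=1..n. \<Delta> * m_pow i) \<le>
        exp (2 * \<mu> * (real n * \<Delta>)) * (E 0 + (\<Sum>i=1..n. \<Delta> * (\<kappa> * D i)))"
    proof (rule discrete_gronwall[where E = E and m = m_pow and D = "\<lambda>i. \<kappa> * D i" and M = M])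
      show "E i + a_low * (\<Delta> * m_pow i) \<le> E (i - 1) + \<mu> * \<Delta> * E i + \<Delta> * (\<kappa> * D i)"
        if "i \<in> {1..M}" for i
        using that by (rule step)
      show "\<mu> * \<Delta> \<le> 1 / 2"
        using \<Delta>_small \<phi>_low by (simp add: \<mu>_def field_simps)
    qed (use E \<Delta> \<mu> \<kappa> D a_low n in \<open>auto simp: m_pow_def\<close>)
    also have "\<dots> \<le> exp (2 * \<mu> * T) * (B * (R + (\<Sum>i=1..n. \<Delta> * D i)))"
    proof (rule mult_mono)
      \<comment> \<open>Replacing the current time by \<open>T\<close> removes the dependence on
        \<open>n\<close> and \<open>\<Delta>\<close>.\<close>
      show "exp (2 * \<mu> * (real n * \<Delta>)) \<le> exp (2 * \<mu> * T)"
        using \<mu> n time_le[of n] by simp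
      have "(\<Sum>i=1..n. \<Delta> * (\<kappa> * D i)) = \<kappa> * (\<Sum>i=1..n. \<Delta> * D i)"
        by (simp add: sum_distrib_left mult.left_commute)
      also have "\<dots> \<le> B * (\<Sum>i=1..n. \<Delta> * D i)"
        using B D \<Delta> by (intro mult_right_mono sum_nonneg) auto
      finally have "(\<Sum>i=1..n. \<Delta> * (\<kappa> * D i)) \<le> B * (\<Sum>i=1..n. \<Delta> * D i)" .
      moreover have "4 * K * R \<le> B * R"
        using B by (intro mult_right_mono) (auto simp: R_def)
      ultimately show "E 0 + (\<Sum>i=1..n. \<Delta> * (\<kappa> * D i)) \<le> B * (R + (\<Sum>i=1..n. \<Delta> * D i))"
        using E0 by (simp add: distrib_left)
      show "0 \<le> E 0 + (\<Sum>i=1..n. \<Delta> * (\<kappa> * D i))"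
        using E[of 0] D \<Delta> \<kappa> by (intro add_nonneg_nonneg sum_nonneg) auto
    qed simp
    finally have S: "E n + a_low * (\<Sum>i=1..n. \<Delta> * m_pow i) \<le>
        exp (2 * \<mu> * T) * (B * (R + (\<Sum>i=1..n. \<Delta> * D i)))" .
    let ?m = "\<Sum>i=1..n. \<Delta> * m_pow i"
    have m_nonneg: "0 \<le> ?m"
      using \<Delta> by (intro sum_nonneg) (auto simp: m_pow_def)
    have "(Lp_norm 2 \<Omega> (\<rho> n))\<^sup>2 + ?m \<le> E n / \<phi>_low + ?m"
      using \<rho>_le[of n] n by simp
    \<comment> \<open>Expanding the product leaves, besides the left side, the cross terms
      \<open>E n / a_low\<close> and \<open>a_low / \<phi>_low * ?m\<close>, both
      nonnegative.\<close>
    also have "\<dots> \<le> (1 / \<phi>_low + 1 / a_low) * (E n + a_low * ?m)"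
      using \<phi>_low a_low E[of n] m_nonneg by (simp add: field_simps)
    also have "\<dots> \<le> (1 / \<phi>_low + 1 / a_low) * (exp (2 * \<mu> * T) * (B * (R + (\<Sum>i=1..n. \<Delta> * D i))))"
      using S \<phi>_low a_low by (intro mult_left_mono) auto
    also have "\<dots> = C * (R + (\<Sum>i=1..n. \<Delta> * D i))"
      by (simp add: C_def mult.assoc)
    finally show "(Lp_norm 2 \<Omega> (\<rho> n))\<^sup>2 + (\<Sum>i=1..n. \<Delta> * Lp_norm s \<Omega> (m i) powr s)
         \<le> C * ((Lp_norm 2 \<Omega> \<rho>0bar)\<^sup>2 +
                (\<Sum>i=1..n. \<Delta> * ((Lp_norm 2 \<Omega> (f (real i * \<Delta>)))\<^sup>2 +
                                  (Lp_norm 2 \<Omega> (\<Psi>t (real i * \<Delta>)))\<^sup>2 +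
                                  Lp_norm s' \<Omega> (grad\<Psi> (real i * \<Delta>)) powr s')))"
      by (simp add: R_def D_def m_pow_def)
  qed
qed

end
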